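(* Let $f\in E$. Then there is a constant $M_f>0$ depending only on $f$ such that for all $b>0$ and all $n,p\in\mathbb{N}$, $$\|\mathcal{L}_{n,p}(f,\cdot)-f\|_{C[0,b]}\le M_f(1+b^2)\,\delta_n(b)+2\,\omega_{b+1}\left(f,\sqrt{\delta_n(b)}\right).$$
   Context: $\mathbb{N}$ denotes the positive integers. For $n,p\in\mathbb{N}$ and suitable $f:[0,\infty)\to\mathbb{R}$, the Baskakov-Schurer-Szász operator is $$\mathcal{L}_{n,p}(f,x)=(n+p)\sum_{k=0}^{\infty}b^k_{n,p}(x)\int_0^\infty f(t)\,s^k_{n,p}(t)\,dt,\qquad x\in[0,\infty),$$ where $b^k_{n,p}(x)=\binom{n+p+k-1}{k}\frac{x^k}{(1+x)^{n+p+k}}$ and $s^k_{n,p}(t)=e^{-(n+p)t}\frac{((n+p)t)^k}{k!}$. $\delta_n(x):=\mathcal{L}_{n,p}((t-x)^2;x)=\frac{1}{n+p}x^2+\frac{2}{n+p}x+\frac{2}{(n+p)^2}$. $E=\left\{f\in C[0,\infty):\lim_{x\to\infty}\frac{f(x)}{1+x^2}\text{ exists and is finite}\right\}$. For $c>0$ and $\delta>0$, $\omega_c(f,\delta)=\sup\{|f(t)-f(x)|: x,t\in[0,c],\ |t-x|\le\delta\}$. $\|g\|_{C[0,b]}=\sup_{x\in[0,b]}|g(x)|$. *)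

theory Defs
  imports "HOL-Analysis.Analysis"
begin

definition baskakov_basis :: "nat \<Rightarrow> nat \<Rightarrow> nat \<Rightarrow> real \<Rightarrow> real" where
  "baskakov_basis n p k x = real ((n + p + k - 1) choose k) * (x ^ k / (1 + x) ^ (n + p + k))"

definition szasz_basis :: "nat \<Rightarrow> nat \<Rightarrow> nat \<Rightarrow> real \<Rightarrow> real" where
  "szasz_basis n p k t = exp (- (real (n + p) * t)) * ((real (n + p) * t) ^ k / fact k)"

definition BSS :: "nat \<Rightarrow> nat \<Rightarrow> (real \<Rightarrow> real) \<Rightarrow> real \<Rightarrow> real" where
  "BSS n p f x =
     real (n + p) * (\<Sum>k. baskakov_basis n p k x * (LBINT t:{0..}. f t * szasz_basis n p k t))"

(* The second central moment; for positive n, p and x \<ge> 0 it equals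
   x^2 / (n + p) + 2 x / (n + p) + 2 / (n + p)^2. *)
definition delta :: "nat \<Rightarrow> nat \<Rightarrow> real \<Rightarrow> real" where
  "delta n p x = BSS n p (\<lambda>t. (t - x)\<^sup>2) x"

(* Functions on [0, \<infinity>) are represented by functions on all reals; their values
   at negative arguments are never used. *)
definition E_space :: "(real \<Rightarrow> real) set" where
  "E_space = {f. continuous_on {0..} f \<and> (\<exists>l. ((\<lambda>x. f x / (1 + x\<^sup>2)) \<longlongrightarrow> l) at_top)}"

definition modulus :: "real \<Rightarrow> (real \<Rightarrow> real) \<Rightarrow> real \<Rightarrow> real" where
  "modulus c f d = Sup {\<bar>f t - f x\<bar> | x t. x \<in> {0..c} \<and> t \<in> {0..c} \<and> \<bar>t - x\<bar> \<le> d}"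

(* Extended-real valued, so that an upper bound on the norm is a pointwise upper bound
   without a separate boundedness condition on g. *)
definition sup_norm :: "real \<Rightarrow> (real \<Rightarrow> real) \<Rightarrow> ereal" where
  "sup_norm b g = (SUP x\<in>{0..b}. ereal \<bar>g x\<bar>)"

end

theory Submission
  imports Defs "HOL-Probability.Distributions"
begin

text \<open>
  Write \<open>N = n + p\<close>. For \<open>x \<ge> 0\<close> the operator is an expectation: a shape \<open>k\<close> is drawn from the
  Baskakov (negative binomial) weights at \<open>x\<close>, and then a point \<open>t\<close> from the Erlang density
  \<open>N * szasz_basis n p k\<close>. It therefore fixes constants and preserves inequalities, so any
  pointwise estimate \<open>\<bar>f t - f x\<bar> \<le> A + B * (t - x)\<^sup>2\<close> passes to
  \<open>\<bar>BSS n p f x - f x\<bar> \<le> A + B * delta n p x\<close> (lemma \<open>BSS_deviation_bound\<close>). Making this rigorous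
  takes only the moments of order at most two of the two families of weights; they justify all
  integrability and summability claims and give \<open>delta\<close> in closed form, whence its monotonicity.

  Fix \<open>x\<close> in \<open>{0..b}\<close>, put \<open>D = delta n p b\<close>, and let \<open>w\<close> be the modulus of \<open>f\<close> on \<open>{0..b + 1}\<close> at
  \<open>sqrt D\<close>. For \<open>t \<le> b + 1\<close>, subdividing the segment from \<open>x\<close> to \<open>t\<close> into pieces of length at most
  \<open>sqrt D\<close> gives \<open>\<bar>f t - f x\<bar> \<le> w * (1 + (t - x)\<^sup>2 / D)\<close> (lemma \<open>abs_diff_le_modulus_quadratic\<close>). For
  \<open>t > b + 1\<close> the distance \<open>t - x\<close> exceeds 1, and the quadratic growth \<open>\<bar>f t\<bar> \<le> K * (1 + t\<^sup>2)\<close> of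
  functions in \<open>E_space\<close> gives \<open>\<bar>f t - f x\<bar> \<le> 4 * K * (1 + b\<^sup>2) * (t - x)\<^sup>2\<close> (lemma \<open>abs_diff_le_far\<close>).
  The sum of the two bounds is of the form above with \<open>A = w\<close> and
  \<open>B = 4 * K * (1 + b\<^sup>2) + w / D\<close>, and since \<open>delta n p x \<le> D\<close> the theorem follows with
  \<open>M = 4 * K\<close>: one copy of \<open>w\<close> is \<open>A\<close>, the other is \<open>(w / D) * D\<close>. Using the quadratic instead of
  the usual linear factor \<open>1 + \<bar>t - x\<bar> / sqrt D\<close> in the near estimate avoids the Cauchy-Schwarz
  inequality for the operator.
\<close>

section \<open>Moments of the Szasz kernel\<close>

lemma szasz_basis_nonneg: "t \<ge> 0 \<Longrightarrow> szasz_basis n p k t \<ge> 0"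
  by (simp add: szasz_basis_def)

text \<open>
  Normalised by \<open>n + p\<close>, the kernel is the Erlang density of shape \<open>k\<close> and rate \<open>n + p\<close>, whose
  moments are known.
\<close>
lemma szasz_basis_erlang:
  assumes "n + p > 0"
  shows "indicat_real {0..} t *\<^sub>R (t ^ m * szasz_basis n p k t)
           = erlang_density k (real (n + p)) t * t ^ m / real (n + p)"
proof -
  have "real (n + p) \<noteq> 0" using assms by linarith
  then show ?thesis
    by (simp add: szasz_basis_def erlang_density_def indicator_def power_mult_distrib mult_ac
        del: of_nat_add of_nat_eq_0_iff)
qed

lemma szasz_moment:
  assumes "n + p > 0"
  shows "set_integrable lborel {0..} (\<lambda>t. t ^ m * szasz_basis n p k t)"
    and "(LBINT t:{0..}. t ^ m * szasz_basis n p k t)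
           = fact (k + m) / (fact k * real (n + p) ^ (m + 1))"
proof -
  let ?N = "real (n + p)"
  let ?h = "\<lambda>t. erlang_density k ?N t * t ^ m"
  have N: "?N > 0" using assms by linarith
  have nonneg: "0 \<le> ?h t" for t
    using N by (cases "t < 0") (auto simp: erlang_density_def)
  have "has_bochner_integral lborel ?h (fact (k + m) / (fact k * ?N ^ m))"
    using nn_integral_erlang_ith_moment[OF N, of k m] N nonneg
    by (intro has_bochner_integral_nn_integral) auto
  then have "has_bochner_integral lborel (\<lambda>t. ?h t / ?N) (fact (k + m) / (fact k * ?N ^ m) / ?N)"
    by (rule has_bochner_integral_divide_zero)
  then have "has_bochner_integral lborel (\<lambda>t. indicat_real {0..} t *\<^sub>R (t ^ m * szasz_basis n p k t))
      (fact (k + m) / (fact k * ?N ^ (m + 1)))"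
    by (simp only: szasz_basis_erlang[OF assms] power_add power_one_right divide_divide_eq_left mult.assoc)
  then show "set_integrable lborel {0..} (\<lambda>t. t ^ m * szasz_basis n p k t)"
    and "(LBINT t:{0..}. t ^ m * szasz_basis n p k t)
           = fact (k + m) / (fact k * ?N ^ (m + 1))"
    unfolding set_integrable_def set_lebesgue_integral_def
    by (auto simp: has_bochner_integral_iff)
qed

lemma szasz_quadratic_moment:
  assumes "n + p > 0"
  shows "set_integrable lborel {0..} (\<lambda>t. (A + B * (t - x)\<^sup>2) * szasz_basis n p k t)"
    and "(LBINT t:{0..}. (A + B * (t - x)\<^sup>2) * szasz_basis n p k t)
         = A / real (n + p) + B * (real ((k + 1) * (k + 2)) / real (n + p) ^ 3
             - 2 * x * real (k + 1) / real (n + p) ^ 2 + x\<^sup>2 / real (n + p))"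
proof -
  let ?m = "\<lambda>i t. t ^ i * szasz_basis n p k t"
  have expand: "(\<lambda>t. (A + B * (t - x)\<^sup>2) * szasz_basis n p k t)
      = (\<lambda>t. B * ?m 2 t - 2 * B * x * ?m 1 t + (A + B * x\<^sup>2) * ?m 0 t)"
    by (auto simp: power2_eq_square algebra_simps)
  have int: "set_integrable lborel {0..} (\<lambda>t. c * ?m i t)" for c i
    using szasz_moment(1)[OF assms] by simp
  show "set_integrable lborel {0..} (\<lambda>t. (A + B * (t - x)\<^sup>2) * szasz_basis n p k t)"
    unfolding expand by (intro set_integral_add set_integral_diff int)
  have "(LBINT t:{0..}. (A + B * (t - x)\<^sup>2) * szasz_basis n p k t)
      = B * (LBINT t:{0..}. ?m 2 t) - 2 * B * x * (LBINT t:{0..}. ?m 1 t)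
          + (A + B * x\<^sup>2) * (LBINT t:{0..}. ?m 0 t)"
    unfolding expand
    by (subst set_integral_add set_integral_diff, (intro set_integral_diff int)+)+
       (simp only: set_integral_mult_right)
  also have "\<dots> = A / real (n + p) + B * (real ((k + 1) * (k + 2)) / real (n + p) ^ 3
             - 2 * x * real (k + 1) / real (n + p) ^ 2 + x\<^sup>2 / real (n + p))"
  proof -
    have "real (n + p) \<noteq> 0" using assms by linarith
    moreover have "fact (k + 2) = fact k * real ((k + 1) * (k + 2))" "fact (k + 1) = fact k * real (k + 1)"
      by (simp_all add: algebra_simps)
    ultimately show ?thesis
      unfolding szasz_moment(2)[OF assms]
      by (simp add: field_simps power2_eq_square power3_eq_cube del: of_nat_add of_nat_mult of_nat_Suc)
  qed
  finally show "(LBINT t:{0..}. (A + B * (t - x)\<^sup>2) * szasz_basis n p k t)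
         = A / real (n + p) + B * (real ((k + 1) * (k + 2)) / real (n + p) ^ 3
             - 2 * x * real (k + 1) / real (n + p) ^ 2 + x\<^sup>2 / real (n + p))" .
qed

section \<open>Moments of the Baskakov weights\<close>

lemma baskakov_basis_nonneg: "x \<ge> 0 \<Longrightarrow> baskakov_basis n p k x \<ge> 0"
  by (simp add: baskakov_basis_def)

text \<open>
  With \<open>y = x / (1 + x)\<close> one has \<open>1 - y = 1 / (1 + x)\<close>, and the claim is the binomial series of
  \<open>(1 - y) powr (- (n + p))\<close>, whose coefficients become ordinary binomials by negating the upper
  index.
\<close>
lemma baskakov_sums_1:
  assumes "n + p > 0" and "x \<ge> 0"
  shows "(\<lambda>k. baskakov_basis n p k x) sums 1"
proof -
  let ?N = "n + p"
  define y where "y = x / (1 + x)"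
  have y: "\<bar>- y\<bar> < 1" "1 + - y = 1 / (1 + x)"
    using assms by (auto simp: y_def field_simps)
  have "(\<lambda>k. (- real ?N gchoose k) * (- y) ^ k) sums (1 + - y) powr (- real ?N)"
    by (rule gen_binomial_real) (rule y)
  moreover have "(- real ?N gchoose k) * (- y) ^ k = real ((?N + k - 1) choose k) * y ^ k" for k
  proof -
    have "real ((?N + k - 1) choose k) = (real ?N + real k - 1) gchoose k"
      using assms by (subst binomial_gbinomial) (simp add: of_nat_diff Suc_le_eq)
    then have "(- real ?N gchoose k) = (- 1) ^ k * real ((?N + k - 1) choose k)"
      by (simp only: gbinomial_minus)
    moreover have "(- 1) ^ k * (- y) ^ k = y ^ k"
      by (simp flip: power_mult_distrib)
    ultimately show ?thesis by (metis mult.commute mult.left_commute)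
  qed
  moreover have "(1 + - y) powr (- real ?N) = (1 + x) ^ ?N"
  proof -
    have "(1 / (1 + x)) powr (- real ?N) = inverse ((1 / (1 + x)) ^ ?N)"
      using assms by (subst powr_minus, subst powr_realpow) auto
    then show ?thesis unfolding y(2) by (simp add: power_divide)
  qed
  ultimately have "(\<lambda>k. real ((?N + k - 1) choose k) * y ^ k) sums (1 + x) ^ ?N" by simp
  then have "(\<lambda>k. real ((?N + k - 1) choose k) * y ^ k / (1 + x) ^ ?N) sums ((1 + x) ^ ?N / (1 + x) ^ ?N)"
    by (rule sums_divide)
  moreover have "real ((?N + k - 1) choose k) * y ^ k / (1 + x) ^ ?N = baskakov_basis n p k x" for k
    by (simp add: baskakov_basis_def y_def power_divide power_add mult_ac)
  ultimately show ?thesis using assms by simp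
qed

text \<open>
  Absorbing a factor \<open>k + 1\<close> into the binomial coefficient shifts the parameter from \<open>n\<close> to
  \<open>n + 1\<close>. This reduces each factorial moment of the weights to the preceding one.
\<close>
lemma baskakov_basis_Suc:
  assumes "n + p > 0"
  shows "real (Suc k) * baskakov_basis n p (Suc k) x
           = real (n + p) * x * baskakov_basis (Suc n) p k x"
proof -
  obtain j where j: "n + p = Suc j" using assms gr0_conv_Suc by blast
  have "Suc k * ((n + p + k) choose Suc k) = (n + p) * ((n + p + k) choose k)"
    using Suc_times_binomial_add[of k j] j by (simp add: add.commute)
  then have "real (Suc k) * real ((n + p + k) choose Suc k) = real (n + p) * real ((n + p + k) choose k)"
    by (metis of_nat_mult)
  then show ?thesis by (simp add: baskakov_basis_def)
qed

lemma baskakov_sums_mean: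
  assumes "n + p > 0" and "x \<ge> 0"
  shows "(\<lambda>k. real k * baskakov_basis n p k x) sums (real (n + p) * x)"
proof -
  have "(\<lambda>k. real (n + p) * x * baskakov_basis (Suc n) p k x) sums (real (n + p) * x * 1)"
    by (rule sums_mult) (rule baskakov_sums_1, use assms in auto)
  then have "(\<lambda>k. real (Suc k) * baskakov_basis n p (Suc k) x) sums (real (n + p) * x)"
    by (simp only: baskakov_basis_Suc[OF assms(1)] mult_1_right)
  then show ?thesis by (rule sums_Suc_imp[rotated]) simp
qed

lemma baskakov_sums_factorial_moment:
  assumes "n + p > 0" and "x \<ge> 0"
  shows "(\<lambda>k. real k * (real k - 1) * baskakov_basis n p k x)
           sums (real (n + p) * (real (n + p) + 1) * x\<^sup>2)"
proof (rule sums_Suc_imp)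
  have "(\<lambda>k. real (n + p) * x * (real k * baskakov_basis (Suc n) p k x))
      sums (real (n + p) * x * (real (Suc n + p) * x))"
    by (rule sums_mult) (rule baskakov_sums_mean, use assms in auto)
  moreover have "real (n + p) * x * (real k * baskakov_basis (Suc n) p k x)
      = real (Suc k) * (real (Suc k) - 1) * baskakov_basis n p (Suc k) x" for k
    using baskakov_basis_Suc[OF assms(1), of k x] by (simp add: mult_ac)
  ultimately show "(\<lambda>k. real (Suc k) * (real (Suc k) - 1) * baskakov_basis n p (Suc k) x)
      sums (real (n + p) * (real (n + p) + 1) * x\<^sup>2)"
    by (simp add: power2_eq_square algebra_simps)
qed simp

section \<open>The second central moment and the deviation of the operator\<close>

text \<open>
  The inner integral is a quadratic polynomial in \<open>k\<close>; in the basis \<open>1\<close>, \<open>k\<close>, \<open>k * (k - 1)\<close> its sum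
  against the Baskakov weights is read off from the factorial moments. The constant term \<open>A\<close>
  makes the same series serve both as the value of \<open>delta\<close> and as the majorant in the deviation
  bound.
\<close>
lemma BSS_quadratic_sums:
  assumes "n + p > 0" and "x \<ge> 0"
  shows "(\<lambda>k. baskakov_basis n p k x * (LBINT t:{0..}. (A + B * (t - x)\<^sup>2) * szasz_basis n p k t))
     sums ((A + B * (x\<^sup>2 / real (n + p) + 2 * x / real (n + p) + 2 / real (n + p) ^ 2)) / real (n + p))"
proof -
  let ?N = "real (n + p)" and ?b = "\<lambda>k. baskakov_basis n p k x"
  have N: "?N > 0" using assms by linarith
  have "(\<lambda>k. (A / ?N + B * (2 / ?N ^ 3 - 2 * x / ?N ^ 2 + x\<^sup>2 / ?N)) * ?b k
          + B * (4 / ?N ^ 3 - 2 * x / ?N ^ 2) * (real k * ?b k)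
          + B / ?N ^ 3 * (real k * (real k - 1) * ?b k))
      sums ((A / ?N + B * (2 / ?N ^ 3 - 2 * x / ?N ^ 2 + x\<^sup>2 / ?N)) * 1
          + B * (4 / ?N ^ 3 - 2 * x / ?N ^ 2) * (?N * x)
          + B / ?N ^ 3 * (?N * (?N + 1) * x\<^sup>2))"
    by (intro sums_add[OF sums_add[OF sums_mult[OF baskakov_sums_1[OF assms]]
          sums_mult[OF baskakov_sums_mean[OF assms]]]
        sums_mult[OF baskakov_sums_factorial_moment[OF assms]]])
  moreover have "(A / ?N + B * (2 / ?N ^ 3 - 2 * x / ?N ^ 2 + x\<^sup>2 / ?N)) * ?b k
          + B * (4 / ?N ^ 3 - 2 * x / ?N ^ 2) * (real k * ?b k)
          + B / ?N ^ 3 * (real k * (real k - 1) * ?b k)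
      = ?b k * (LBINT t:{0..}. (A + B * (t - x)\<^sup>2) * szasz_basis n p k t)" for k
    unfolding szasz_quadratic_moment(2)[OF assms(1)]
    by (simp add: algebra_simps add_divide_distrib diff_divide_distrib del: of_nat_add)
       (simp add: algebra_simps add_divide_distrib)
  moreover have "(A / ?N + B * (2 / ?N ^ 3 - 2 * x / ?N ^ 2 + x\<^sup>2 / ?N)) * 1
          + B * (4 / ?N ^ 3 - 2 * x / ?N ^ 2) * (?N * x)
          + B / ?N ^ 3 * (?N * (?N + 1) * x\<^sup>2)
      = (A + B * (x\<^sup>2 / ?N + 2 * x / ?N + 2 / ?N ^ 2)) / ?N"
    using less_imp_neq[OF N, symmetric] by (simp add: field_simps power2_eq_square power3_eq_cube del: of_nat_add)
  ultimately show ?thesis by simp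
qed

lemma delta_eq:
  assumes "n + p > 0" and "x \<ge> 0"
  shows "delta n p x = x\<^sup>2 / real (n + p) + 2 * x / real (n + p) + 2 / real (n + p) ^ 2"
proof -
  have "real (n + p) \<noteq> 0" using assms by linarith
  then show ?thesis
    using sums_unique[OF BSS_quadratic_sums[OF assms, of 0 1], symmetric]
    by (simp add: delta_def BSS_def del: of_nat_add of_nat_eq_0_iff)
qed

lemma delta_pos:
  assumes "n + p > 0" and "x \<ge> 0"
  shows "delta n p x > 0"
  unfolding delta_eq[OF assms] using assms
  by (intro add_nonneg_pos add_nonneg_nonneg divide_nonneg_nonneg divide_pos_pos zero_less_power) auto

lemma delta_mono:
  assumes "n + p > 0" and "0 \<le> x" and "x \<le> y"
  shows "delta n p x \<le> delta n p y"
proof -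
  have "y \<ge> 0" using assms by linarith
  show ?thesis
    unfolding delta_eq[OF assms(1,2)] delta_eq[OF assms(1) \<open>y \<ge> 0\<close>]
    using assms by (intro add_mono divide_right_mono power_mono mult_left_mono) auto
qed

text \<open>
  This is linearity and positivity of the operator in one statement: subtract the constant \<open>c\<close>,
  which the operator reproduces, and apply the triangle inequality under the integral and the
  sum. The quadratic on the right also dominates \<open>f - c\<close>, so that the integrals and the series
  converge absolutely.
\<close>
lemma BSS_deviation_bound:
  assumes N: "n + p > 0" and x: "x \<ge> 0" and cont: "continuous_on {0..} f"
    and bound: "\<And>t. t \<ge> 0 \<Longrightarrow> \<bar>f t - c\<bar> \<le> A + B * (t - x)\<^sup>2"
  shows "\<bar>BSS n p f x - c\<bar> \<le> A + B * delta n p x"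
proof -
  let ?N = "real (n + p)" and ?b = "\<lambda>k. baskakov_basis n p k x"
  define E where "E k h = (LBINT t:{0..}. h t * szasz_basis n p k t)" for k and h :: "real \<Rightarrow> real"
  let ?q = "\<lambda>t. A + B * (t - x)\<^sup>2"
  let ?g = "\<lambda>t. f t - c"
  have N': "?N > 0" using N by linarith
  have q_int: "set_integrable lborel {0..} (\<lambda>t. ?q t * szasz_basis n p k t)" for k
    by (rule szasz_quadratic_moment(1)[OF N])
  have g_int: "set_integrable lborel {0..} (\<lambda>t. ?g t * szasz_basis n p k t)" for k
  proof (rule set_integrable_bound[OF q_int[of k]])
    have "continuous_on {0..} (\<lambda>t. ?g t * szasz_basis n p k t)"
      unfolding szasz_basis_def by (intro continuous_intros cont) auto
    then show "set_borel_measurable lborel {0..} (\<lambda>t. ?g t * szasz_basis n p k t)"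
      unfolding set_borel_measurable_def
      using borel_measurable_continuous_on_indicator[of "{0::real..}"] by (simp del: real_scaleR_def)
    show "AE t in lborel. t \<in> {0..} \<longrightarrow>
        norm (?g t * szasz_basis n p k t) \<le> norm (?q t * szasz_basis n p k t)"
    proof (intro AE_I2 impI)
      fix t :: real assume "t \<in> {0..}"
      then show "norm (?g t * szasz_basis n p k t) \<le> norm (?q t * szasz_basis n p k t)"
        using bound[of t] szasz_basis_nonneg[of t n p k]
        by (auto simp: abs_mult intro!: mult_right_mono)
    qed
  qed
  have E_f: "E k f = E k ?g + c / ?N" for k
  proof -
    have const: "set_integrable lborel {0..} (\<lambda>t. c * szasz_basis n p k t)"
      using szasz_quadratic_moment(1)[OF N, of c 0] by simp
    have "E k f = (LBINT t:{0..}. ?g t * szasz_basis n p k t + c * szasz_basis n p k t)"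
      by (simp add: E_def algebra_simps)
    also have "\<dots> = E k ?g + (LBINT t:{0..}. c * szasz_basis n p k t)"
      unfolding E_def by (rule set_integral_add(2)[OF g_int const])
    also have "(LBINT t:{0..}. c * szasz_basis n p k t) = c / ?N"
      using szasz_quadratic_moment(2)[OF N, of c 0] by simp
    finally show ?thesis .
  qed
  have E_g: "\<bar>E k ?g\<bar> \<le> E k ?q" for k
  proof -
    have "\<bar>E k ?g\<bar> \<le> (LBINT t:{0..}. \<bar>?g t * szasz_basis n p k t\<bar>)"
      using set_integral_norm_bound[OF g_int] by (simp add: E_def)
    also have "\<dots> \<le> E k ?q"
      unfolding E_def
    proof (rule set_integral_mono[OF set_integrable_abs[OF g_int] q_int])
      fix t :: real assume "t \<in> {0..}"
      then show "\<bar>?g t * szasz_basis n p k t\<bar> \<le> ?q t * szasz_basis n p k t"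
        using bound[of t] szasz_basis_nonneg[of t n p k]
        by (auto simp: abs_mult intro!: mult_right_mono)
    qed
    finally show ?thesis .
  qed
  have q_sums: "(\<lambda>k. ?b k * E k ?q) sums ((A + B * delta n p x) / ?N)"
    unfolding E_def delta_eq[OF N x] by (rule BSS_quadratic_sums[OF N x])
  have dominated: "\<bar>?b k * E k ?g\<bar> \<le> ?b k * E k ?q" for k
    using E_g[of k] baskakov_basis_nonneg[OF x, of n p k] by (simp add: abs_mult mult_left_mono)
  have g_abs_summable: "summable (\<lambda>k. \<bar>?b k * E k ?g\<bar>)"
    by (rule summable_rabs_comparison_test[OF _ sums_summable[OF q_sums]]) (use dominated in auto)
  have "(\<lambda>k. ?b k * E k ?g + ?b k * (c / ?N)) sums ((\<Sum>k. ?b k * E k ?g) + 1 * (c / ?N))"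
    by (intro sums_add summable_sums[OF summable_rabs_cancel[OF g_abs_summable]]
          sums_mult2 baskakov_sums_1 N x)
  then have "(\<Sum>k. ?b k * E k f) = (\<Sum>k. ?b k * E k ?g) + c / ?N"
    by (simp add: E_f distrib_left sums_iff)
  then have "BSS n p f x - c = ?N * (\<Sum>k. ?b k * E k ?g)"
    using N' by (simp add: BSS_def E_def field_simps del: of_nat_add)
  also have "\<bar>\<dots>\<bar> \<le> ?N * ((A + B * delta n p x) / ?N)"
  proof -
    have "\<bar>\<Sum>k. ?b k * E k ?g\<bar> \<le> (\<Sum>k. \<bar>?b k * E k ?g\<bar>)"
      by (rule summable_rabs[OF g_abs_summable])
    also have "(\<Sum>k. \<bar>?b k * E k ?g\<bar>) \<le> (A + B * delta n p x) / ?N"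
      using suminf_le[OF dominated g_abs_summable sums_summable[OF q_sums]] sums_unique[OF q_sums]
      by simp
    finally have "\<bar>\<Sum>k. ?b k * E k ?g\<bar> \<le> (A + B * delta n p x) / ?N" .
    then have "?N * \<bar>\<Sum>k. ?b k * E k ?g\<bar> \<le> ?N * ((A + B * delta n p x) / ?N)"
      by (rule mult_left_mono) simp
    then show ?thesis by (simp only: abs_mult abs_of_nat)
  qed
  finally show ?thesis using N' by simp
qed

section \<open>Pointwise bounds on increments of the function\<close>

text \<open>
  Continuity on the compact interval bounds the set under the supremum, without which \<open>Sup\<close> on the
  reals need not be an upper bound.
\<close>
lemma abs_diff_le_modulus:
  assumes "continuous_on {0..c} f" and "x \<in> {0..c}" and "t \<in> {0..c}" and "\<bar>t - x\<bar> \<le> d"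
  shows "\<bar>f t - f x\<bar> \<le> modulus c f d"
proof -
  have "bounded (f ` {0..c})"
    by (intro compact_imp_bounded compact_continuous_image assms) auto
  then obtain K where K: "\<And>y. y \<in> {0..c} \<Longrightarrow> \<bar>f y\<bar> \<le> K"
    by (force simp: bounded_iff)
  have "bdd_above {\<bar>f t - f x\<bar> | x t. x \<in> {0..c} \<and> t \<in> {0..c} \<and> \<bar>t - x\<bar> \<le> d}"
  proof (rule bdd_aboveI)
    fix z assume "z \<in> {\<bar>f t - f x\<bar> | x t. x \<in> {0..c} \<and> t \<in> {0..c} \<and> \<bar>t - x\<bar> \<le> d}"
    then obtain u v where z: "z = \<bar>f v - f u\<bar>" "u \<in> {0..c}" "v \<in> {0..c}" by blast
    show "z \<le> 2 * K" using K[OF z(2)] K[OF z(3)] z(1) by linarith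
  qed
  then show ?thesis
    unfolding modulus_def by (rule cSup_upper[rotated]) (use assms in blast)
qed

lemma abs_diff_le_multiple_modulus:
  assumes "continuous_on {0..c} f" and "x \<in> {0..c}" and "t \<in> {0..c}"
    and "\<bar>t - x\<bar> \<le> real m * d"
  shows "\<bar>f t - f x\<bar> \<le> real m * modulus c f d"
  using assms(3,4)
proof (induction m arbitrary: t)
  case 0
  then show ?case by simp
next
  case (Suc m)
  \<comment> \<open>The point \<open>z\<close> below cuts off the last of \<open>m + 1\<close> equal pieces of the segment from \<open>x\<close> to \<open>t\<close>.\<close>
  define r where "r = real m / real (Suc m)"
  have r: "0 \<le> r" "r \<le> 1" by (auto simp: r_def field_simps)
  define z where "z = (1 - r) * x + r * t"
  have "z \<in> {0..c}"
    using convexD[of "{0..c}" x t "1 - r" r] assms(2) Suc.prems(1) r by (auto simp: z_def)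
  have zx: "\<bar>z - x\<bar> = r * \<bar>t - x\<bar>" and tz: "\<bar>t - z\<bar> = (1 - r) * \<bar>t - x\<bar>"
  proof -
    have "z - x = r * (t - x)" "t - z = (1 - r) * (t - x)"
      by (auto simp: z_def algebra_simps)
    then show "\<bar>z - x\<bar> = r * \<bar>t - x\<bar>" "\<bar>t - z\<bar> = (1 - r) * \<bar>t - x\<bar>"
      using r by (auto simp: abs_mult)
  qed
  have "\<bar>z - x\<bar> \<le> r * (real (Suc m) * d)"
    unfolding zx by (rule mult_left_mono[OF Suc.prems(2) r(1)])
  then have "\<bar>f z - f x\<bar> \<le> real m * modulus c f d"
    by (intro Suc.IH \<open>z \<in> {0..c}\<close>) (simp add: r_def)
  moreover have "\<bar>t - z\<bar> \<le> (1 - r) * (real (Suc m) * d)"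
    unfolding tz by (rule mult_left_mono[OF Suc.prems(2)]) (use r in simp)
  then have "\<bar>t - z\<bar> \<le> d"
  proof -
    have "(1 - r) * (real (Suc m) * d) = d" by (simp add: r_def field_simps)
    then show ?thesis using \<open>\<bar>t - z\<bar> \<le> (1 - r) * (real (Suc m) * d)\<close> by (simp only:)
  qed
  then have "\<bar>f t - f z\<bar> \<le> modulus c f d"
    by (rule abs_diff_le_modulus[OF assms(1) \<open>z \<in> {0..c}\<close> Suc.prems(1)])
  ultimately show ?case by (simp add: algebra_simps)
qed

text \<open>
  The number of steps of length \<open>d\<close> needed to go from \<open>x\<close> to \<open>t\<close> is the ceiling of
  \<open>r = \<bar>t - x\<bar> / d\<close>. One step suffices if \<open>r \<le> 1\<close>, and otherwise the ceiling is at most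
  \<open>1 + r \<le> 1 + r\<^sup>2\<close>.
\<close>
lemma abs_diff_le_modulus_quadratic:
  assumes "continuous_on {0..c} f" and "x \<in> {0..c}" and "t \<in> {0..c}" and "d > 0"
  shows "\<bar>f t - f x\<bar> \<le> modulus c f d * (1 + (t - x)\<^sup>2 / d\<^sup>2)"
proof -
  have nonneg: "modulus c f d \<ge> 0"
    using abs_diff_le_modulus[OF assms(1,2,2), of d] assms(4) by simp
  define r where "r = \<bar>t - x\<bar> / d"
  have r: "r \<ge> 0" "\<bar>t - x\<bar> = r * d" "(t - x)\<^sup>2 / d\<^sup>2 = r\<^sup>2"
    using assms(4) by (auto simp: r_def power_divide)
  obtain m where m: "r \<le> real m" "real m \<le> 1 + r\<^sup>2"
  proof (cases "r \<le> 1")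
    case True
    then show ?thesis using that[of 1] by simp
  next
    case False
    have "real (nat \<lceil>r\<rceil>) \<le> 1 + r" using r(1) by linarith
    also have "r \<le> r\<^sup>2" using False by (simp add: power2_eq_square)
    finally show ?thesis using that[of "nat \<lceil>r\<rceil>"] by (simp add: real_nat_ceiling_ge)
  qed
  have "\<bar>f t - f x\<bar> \<le> real m * modulus c f d"
    using m(1) assms(4) r(2) by (intro abs_diff_le_multiple_modulus assms) (simp add: mult_right_mono)
  also have "\<dots> \<le> (1 + r\<^sup>2) * modulus c f d"
    by (rule mult_right_mono[OF m(2) nonneg])
  finally show ?thesis by (simp add: r(3) mult.commute)
qed

text \<open>
  Beyond some \<open>R\<close> the weighted quotient is within 1 of its limit; on \<open>{0..R}\<close> continuity bounds \<open>f\<close>.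
\<close>
lemma E_space_growth:
  assumes "f \<in> E_space"
  obtains K where "K > 0" and "\<And>t. t \<ge> 0 \<Longrightarrow> \<bar>f t\<bar> \<le> K * (1 + t\<^sup>2)"
proof -
  from assms obtain l where cont: "continuous_on {0..} f"
    and l: "((\<lambda>x. f x / (1 + x\<^sup>2)) \<longlongrightarrow> l) at_top"
    by (auto simp: E_space_def)
  from tendstoD[OF l, of 1] obtain R where R: "\<And>x. x \<ge> R \<Longrightarrow> dist (f x / (1 + x\<^sup>2)) l < 1"
    by (auto simp: eventually_at_top_linorder)
  have "bounded (f ` {0..R})"
    by (intro compact_imp_bounded compact_continuous_image continuous_on_subset[OF cont]) auto
  then obtain C where C: "\<And>y. y \<in> {0..R} \<Longrightarrow> \<bar>f y\<bar> \<le> C"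
    by (force simp: bounded_iff)
  show ?thesis
  proof (rule that[of "\<bar>l\<bar> + 1 + \<bar>C\<bar>"])
    fix t :: real assume "t \<ge> 0"
    have pos: "1 + t\<^sup>2 \<ge> 1" by simp
    show "\<bar>f t\<bar> \<le> (\<bar>l\<bar> + 1 + \<bar>C\<bar>) * (1 + t\<^sup>2)"
    proof (cases "t \<le> R")
      case True
      then have "\<bar>f t\<bar> \<le> (\<bar>l\<bar> + 1 + \<bar>C\<bar>) * 1" using C[of t] \<open>t \<ge> 0\<close> by simp
      also have "\<dots> \<le> (\<bar>l\<bar> + 1 + \<bar>C\<bar>) * (1 + t\<^sup>2)" by (rule mult_left_mono[OF pos]) simp
      finally show ?thesis .
    next
      case False
      then have "\<bar>f t / (1 + t\<^sup>2)\<bar> \<le> \<bar>l\<bar> + 1 + \<bar>C\<bar>"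
        using R[of t] by (simp add: dist_real_def)
      then show ?thesis using pos by (simp add: abs_divide pos_divide_le_eq)
    qed
  qed simp
qed

text \<open>
  Since \<open>t\<^sup>2 \<le> 2 * (t - x)\<^sup>2 + 2 * x\<^sup>2\<close>, the growth bound leaves terms in \<open>(t - x)\<^sup>2\<close> and in \<open>b\<close>
  only; the terms in \<open>b\<close> are multiplied by \<open>(t - x)\<^sup>2 \<ge> 1\<close>.
\<close>
lemma abs_diff_le_far:
  fixes f :: "real \<Rightarrow> real"
  assumes K: "\<And>t. t \<ge> 0 \<Longrightarrow> \<bar>f t\<bar> \<le> K * (1 + t\<^sup>2)" and "K > 0"
    and "0 \<le> x" and "x \<le> b" and "t \<ge> 0" and far: "t - x \<ge> 1"
  shows "\<bar>f t - f x\<bar> \<le> 4 * K * (1 + b\<^sup>2) * (t - x)\<^sup>2"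
proof -
  have x2: "x\<^sup>2 \<le> b\<^sup>2" using assms by (intro power_mono) auto
  have far2: "1 \<le> (t - x)\<^sup>2" using far by (simp add: one_le_power)
  have t2: "t\<^sup>2 \<le> 2 * (t - x)\<^sup>2 + 2 * x\<^sup>2"
    using zero_le_power2[of "t - 2 * x"] by (simp add: power2_eq_square algebra_simps)
  have "\<bar>f t - f x\<bar> \<le> K * (1 + t\<^sup>2) + K * (1 + x\<^sup>2)"
    using K[of t] K[of x] assms by linarith
  also have "\<dots> = K * (2 + t\<^sup>2 + x\<^sup>2)" by (simp add: algebra_simps)
  also have "\<dots> \<le> K * (4 * (1 + b\<^sup>2) * (t - x)\<^sup>2)"
  proof (rule mult_left_mono)
    have "2 + t\<^sup>2 + x\<^sup>2 \<le> (2 + 3 * b\<^sup>2) * 1 + 2 * (t - x)\<^sup>2"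
      unfolding mult_1_right using t2 x2 by (smt (verit))
    also have "\<dots> \<le> (2 + 3 * b\<^sup>2) * (t - x)\<^sup>2 + 2 * (t - x)\<^sup>2"
      by (intro add_right_mono mult_left_mono far2) simp
    also have "\<dots> \<le> 4 * (1 + b\<^sup>2) * (t - x)\<^sup>2"
      by (simp add: algebra_simps)
    finally show "2 + t\<^sup>2 + x\<^sup>2 \<le> 4 * (1 + b\<^sup>2) * (t - x)\<^sup>2" .
  qed (use \<open>K > 0\<close> in simp)
  finally show ?thesis by (simp add: mult_ac)
qed

section \<open>The error estimate\<close>

theorem theorem6:
  fixes f :: "real \<Rightarrow> real"
  assumes "f \<in> E_space"
  shows "\<exists>M>0. \<forall>b>0. \<forall>n\<ge>1. \<forall>p\<ge>1.
           sup_norm b (\<lambda>x. BSS n p f x - f x)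
             \<le> ereal (M * (1 + b\<^sup>2) * delta n p b + 2 * modulus (b + 1) f (sqrt (delta n p b)))"
proof -
  obtain K where K: "K > 0" "\<And>t. t \<ge> 0 \<Longrightarrow> \<bar>f t\<bar> \<le> K * (1 + t\<^sup>2)"
    using E_space_growth[OF assms] by blast
  have cont: "continuous_on {0..} f" using assms by (simp add: E_space_def)
  have "sup_norm b (\<lambda>x. BSS n p f x - f x)
      \<le> ereal (4 * K * (1 + b\<^sup>2) * delta n p b + 2 * modulus (b + 1) f (sqrt (delta n p b)))"
    if b: "b > 0" and N: "n + p > 0" for b n p
    unfolding sup_norm_def
  proof (rule SUP_least)
    fix x assume x: "x \<in> {0..b}"
    define D where "D = delta n p b"
    define w where "w = modulus (b + 1) f (sqrt D)"
    have D: "D > 0" unfolding D_def using b by (intro delta_pos N) simp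
    have cont_b: "continuous_on {0..b + 1} f"
      by (rule continuous_on_subset[OF cont]) auto
    have near: "\<bar>f t - f x\<bar> \<le> w * (1 + (t - x)\<^sup>2 / D)" if "t \<in> {0..b + 1}" for t
      using abs_diff_le_modulus_quadratic[OF cont_b _ that, of x "sqrt D"] x D by (simp add: w_def)
    have w: "w \<ge> 0" using near[of x] x by simp
    have "\<bar>f t - f x\<bar> \<le> w + (4 * K * (1 + b\<^sup>2) + w / D) * (t - x)\<^sup>2" if "t \<ge> 0" for t
    proof (cases "t \<le> b + 1")
      case True
      have "0 \<le> 4 * K * (1 + b\<^sup>2) * (t - x)\<^sup>2" using K by simp
      then show ?thesis using near[of t] that True by (simp add: algebra_simps)
    next
      case False
      have "\<bar>f t - f x\<bar> \<le> 4 * K * (1 + b\<^sup>2) * (t - x)\<^sup>2"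
        by (rule abs_diff_le_far[OF K(2,1)]) (use x that False in auto)
      moreover have "0 \<le> w / D * (t - x)\<^sup>2" using w D by simp
      ultimately show ?thesis using w by (simp add: distrib_right)
    qed
    then have "\<bar>BSS n p f x - f x\<bar> \<le> w + (4 * K * (1 + b\<^sup>2) + w / D) * delta n p x"
      using x by (intro BSS_deviation_bound N cont) auto
    also have "\<dots> \<le> w + (4 * K * (1 + b\<^sup>2) + w / D) * D"
      unfolding D_def using x K w D
      by (intro add_left_mono mult_left_mono delta_mono N) (auto simp: D_def)
    also have "\<dots> = 4 * K * (1 + b\<^sup>2) * D + 2 * w"
      using D by (simp add: field_simps)
    finally show "ereal \<bar>BSS n p f x - f x\<bar>
        \<le> ereal (4 * K * (1 + b\<^sup>2) * delta n p b + 2 * modulus (b + 1) f (sqrt (delta n p b)))"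
      by (simp add: D_def w_def)
  qed
  then show ?thesis using K(1) by (intro exI[of _ "4 * K"]) simp
qed

end
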